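(* Let $\phi$ be the Laplace exponent and $\nu$ the Lévy measure of a subordinator. Suppose that there are $x_0\ge 0$, $C\ge 1$ and $\alpha>0$ such that for all $0<r<1/x_0$ and $0<\lambda\le 1$, $$\nu\big((r,\infty)\big)\le C\lambda^{\alpha}\,\nu\big((\lambda r,\infty)\big).$$ Then $-\phi''\in\mathrm{WLSC}(\alpha-2,c,x_0)$ for some $c\in(0,1]$.
   Context: A subordinator is a one-dimensional Lévy process $(T_t\colon t\ge 0)$ with $T_0=0$ and nondecreasing paths. Its Laplace exponent $\phi\colon[0,\infty)\to[0,\infty)$ is defined by $\mathbb{E}\,e^{-\lambda T_t}=e^{-t\phi(\lambda)}$, and $\phi(\lambda)=b\lambda+\int_{(0,\infty)}(1-e^{-\lambda s})\,\nu(\mathrm{d}s)$, where $b\ge 0$ and $\nu$ (the Lévy measure) satisfies $\int_{(0,\infty)}\min\{1,s\}\,\nu(\mathrm{d}s)<\infty$. It is assumed that $\phi''\not\equiv 0$. For $\tau\in\mathbb{R}$, $c\in(0,1]$, $x_0\ge 0$, a nonnegative function $f$ on $(0,\infty)$ belongs to $\mathrm{WLSC}(\tau,c,x_0)$ if $f(\lambda x)\ge c\lambda^{\tau}f(x)$ for all $\lambda\ge 1$ and $x>x_0$. Convention: $1/x_0=\infty$ when $x_0=0$. *)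

theory Defs
  imports "HOL-Probability.Probability"
begin

text \<open>
  Processes are indexed by \<^typ>\<open>real\<close>; only times \<open>t \<ge> 0\<close> are ever constrained.
\<close>

definition levy_process :: "'a measure \<Rightarrow> (real \<Rightarrow> 'a \<Rightarrow> real) \<Rightarrow> bool" where
  "levy_process M T \<longleftrightarrow>
     prob_space M \<and>
     (\<forall>t\<ge>0. T t \<in> borel_measurable M) \<and>
     (AE \<omega> in M. T 0 \<omega> = 0) \<and>
     (\<forall>(n::nat) (t::nat \<Rightarrow> real). 0 \<le> t 0 \<and> (\<forall>i<n. t i \<le> t (Suc i)) \<longrightarrow>
        prob_space.indep_vars M (\<lambda>_. borel) (\<lambda>i \<omega>. T (t (Suc i)) \<omega> - T (t i) \<omega>) {..<n}) \<and>
     (\<forall>s\<ge>0. \<forall>t\<ge>0. distr M borel (\<lambda>\<omega>. T (s + t) \<omega> - T s \<omega>) =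
                     distr M borel (\<lambda>\<omega>. T t \<omega> - T 0 \<omega>)) \<and>
     (\<forall>t\<ge>0. \<forall>\<epsilon>>0.
        ((\<lambda>s. measure M {\<omega> \<in> space M. \<bar>T s \<omega> - T t \<omega>\<bar> > \<epsilon>}) \<longlongrightarrow> 0) (at t within {0..})) \<and>
     (AE \<omega> in M. (\<forall>t\<ge>0. continuous (at_right t) (\<lambda>s. T s \<omega>)) \<and>
                  (\<forall>t>0. \<exists>l. ((\<lambda>s. T s \<omega>) \<longlongrightarrow> l) (at_left t)))"

definition subordinator :: "'a measure \<Rightarrow> (real \<Rightarrow> 'a \<Rightarrow> real) \<Rightarrow> bool" where
  "subordinator M T \<longleftrightarrow>
     levy_process M T \<and> (AE \<omega> in M. mono_on {0..} (\<lambda>t. T t \<omega>))"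

definition laplace_exponent ::
  "'a measure \<Rightarrow> (real \<Rightarrow> 'a \<Rightarrow> real) \<Rightarrow> (real \<Rightarrow> real) \<Rightarrow> bool" where
  "laplace_exponent M T \<phi> \<longleftrightarrow>
     (\<forall>l\<ge>0. 0 \<le> \<phi> l \<and>
        (\<forall>t\<ge>0. (LINT \<omega>|M. exp (- l * T t \<omega>)) = exp (- t * \<phi> l)))"

text \<open>
  A measure on \<open>(0, \<infinity>)\<close> is encoded as a Borel measure on the whole line that does not
  charge \<open>(-\<infinity>, 0]\<close>. The drift \<open>b\<close> and the measure \<open>\<nu>\<close> are uniquely
  determined by the values of \<open>\<phi>\<close> on \<open>[0, \<infinity>)\<close>.
\<close>

definition levy_measure :: "(real \<Rightarrow> real) \<Rightarrow> real measure \<Rightarrow> bool" where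
  "levy_measure \<phi> \<nu> \<longleftrightarrow>
     sets \<nu> = sets borel \<and>
     emeasure \<nu> {..0} = 0 \<and>
     (\<integral>\<^sup>+s\<in>{0<..}. ennreal (min 1 s) \<partial>\<nu>) < \<infinity> \<and>
     (\<exists>b\<ge>0. \<forall>l\<ge>0. \<phi> l = b * l + (LINT s:{0<..}|\<nu>. 1 - exp (- l * s)))"

text \<open>
  Functions on \<open>(0, \<infinity>)\<close> are total functions on \<^typ>\<open>real\<close> whose values at
  nonpositive arguments are irrelevant.
\<close>

definition WLSC :: "real \<Rightarrow> real \<Rightarrow> real \<Rightarrow> (real \<Rightarrow> real) set" where
  "WLSC \<tau> c x\<^sub>0 =
     {f. (\<forall>x>0. 0 \<le> f x) \<and> (\<forall>l\<ge>1. \<forall>x>x\<^sub>0. f (l * x) \<ge> c * l powr \<tau> * f x)}"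

end

theory Submission
  imports Defs
begin

text \<open>
  Write \<open>N r = \<nu> (r, \<infinity>)\<close>, \<open>F x = -\<phi>'' x\<close> and \<open>K a = \<integral> (min s a)\<^sup>2 \<nu>(ds)\<close>. Differentiating
  the representation of \<open>\<phi>\<close> twice under the integral sign gives
  \<open>F x = \<integral> s\<^sup>2 exp (-x s) \<nu>(ds)\<close> for \<open>x > 0\<close> (\<open>second_deriv_laplace_exponent\<close>). The proof
  compares \<open>F x\<close> with \<open>K (1/x)\<close>, because \<open>K\<close> inherits the scaling of \<open>N\<close> directly.

  The bound \<open>F x \<le> K (1/x)\<close> holds for every \<open>\<nu>\<close>, pointwise in \<open>s\<close>
  (\<open>exp_integral_le_truncated_square_integral\<close>). By Fubini,
  \<open>K a = \<integral> 2 u N u du\<close> over \<open>[0, a]\<close>, and similarly for \<open>min (l s) a\<close> with \<open>N (u/l)\<close>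
  (\<open>truncated_square_eq_tail_integral\<close>). The hypothesis
  \<open>N u \<le> C * l powr (-\<alpha>) * N (u/l)\<close> for \<open>u \<le> 1/x\<close> therefore yields
  \<open>K (1/x) \<le> C * l powr (2 - \<alpha>) * K (1/(l x))\<close> (\<open>truncated_square_integral_scaling\<close>).

  It remains to bound \<open>K (1/y)\<close> by a multiple of \<open>F y\<close>, where \<open>y = l x\<close>. On \<open>(0, 1/y]\<close> the
  integrands are comparable, so only the part \<open>N (1/y) / y\<^sup>2\<close> of \<open>K (1/y)\<close> from large \<open>s\<close> matters.
  For \<open>q = (2 C) powr (-1/\<alpha>)\<close> the hypothesis gives \<open>2 N (1/y) \<le> N (q/y)\<close>, so the interval
  \<open>(q/y, 1/y]\<close> has at least the mass \<open>N (1/y)\<close>, and there \<open>s\<^sup>2 \<ge> (q/y)\<^sup>2\<close>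
  (\<open>truncated_square_integral_le_exp_integral\<close>). Chaining the three bounds gives
  \<open>exp_integral_scaling\<close>, which is the assertion.
\<close>

section \<open>Differentiation under the integral sign\<close>

lemma has_real_derivative_quadratic_remainder:
  fixes f :: "real \<Rightarrow> real"
  assumes "d > 0"
    and rem: "\<And>h. \<bar>h\<bar> \<le> d \<Longrightarrow> \<bar>f (x + h) - f x - h * D\<bar> \<le> B * h\<^sup>2"
  shows "(f has_real_derivative D) (at x)"
proof -
  have "((\<lambda>h. (f (x + h) - f x) / h - D) \<longlongrightarrow> 0) (at 0)"
  proof (rule Lim_null_comparison)
    show "\<forall>\<^sub>F h in at 0. norm ((f (x + h) - f x) / h - D) \<le> B * \<bar>h\<bar>"
    proof (unfold eventually_at, intro exI[of _ d] conjI ballI impI)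
      fix h :: real assume h: "h \<noteq> 0 \<and> dist h 0 < d"
      have "\<bar>(f (x + h) - f x) / h - D\<bar> * \<bar>h\<bar> = \<bar>f (x + h) - f x - h * D\<bar>"
        using h by (simp add: abs_mult [symmetric] field_simps)
      also have "\<dots> \<le> (B * \<bar>h\<bar>) * \<bar>h\<bar>"
        using rem[of h] h by (simp add: power2_eq_square mult.assoc abs_mult [symmetric])
      finally show "norm ((f (x + h) - f x) / h - D) \<le> B * \<bar>h\<bar>"
        using h by (simp add: mult_le_cancel_right)
    qed (use \<open>d > 0\<close> in auto)
    show "((\<lambda>h. B * \<bar>h\<bar>) \<longlongrightarrow> 0) (at 0)"
      by (auto intro!: tendsto_eq_intros)
  qed
  then show ?thesis
    by (simp add: DERIV_def LIM_zero_iff)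
qed

lemma has_real_derivative_integral:
  fixes p :: "real \<Rightarrow> 'b \<Rightarrow> real"
  assumes "d > 0"
    and p: "\<And>h. \<bar>h\<bar> \<le> d \<Longrightarrow> integrable M (p (x + h))"
    and q: "integrable M q" and g: "integrable M g"
    and rem: "\<And>h. \<bar>h\<bar> \<le> d \<Longrightarrow>
      AE s in M. \<bar>p (x + h) s - p x s - h * q s\<bar> \<le> h\<^sup>2 * g s"
  shows "((\<lambda>y. LINT s|M. p y s) has_real_derivative (LINT s|M. q s)) (at x)"
proof (rule has_real_derivative_quadratic_remainder[OF \<open>d > 0\<close>])
  fix h assume h: "\<bar>h\<bar> \<le> d"
  have px: "integrable M (p x)" using p[of 0] \<open>d > 0\<close> by simp
  have "(LINT s|M. p (x + h) s) - (LINT s|M. p x s) - h * (LINT s|M. q s)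
      = (LINT s|M. p (x + h) s - p x s - h * q s)"
    using p[OF h] px q by simp
  also have "\<bar>\<dots>\<bar> \<le> (LINT s|M. h\<^sup>2 * g s)"
  proof (rule order_trans[OF integral_abs_bound integral_mono_AE])
    show "AE s in M. \<bar>p (x + h) s - p x s - h * q s\<bar> \<le> h\<^sup>2 * g s"
      by (rule rem[OF h])
  qed (use p[OF h] px q g in auto)
  finally show "\<bar>(LINT s|M. p (x + h) s) - (LINT s|M. p x s) - h * (LINT s|M. q s)\<bar>
      \<le> (LINT s|M. g s) * h\<^sup>2"
    by (simp add: mult.commute)
qed

text \<open>
  The restriction on \<open>h\<close> keeps \<open>x + h\<close> above \<open>x / 2\<close>, so the second-order Taylor remainder is
  still dominated by an exponentially decaying function of \<open>s\<close>.
\<close>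
lemma exp_neg_quadratic_remainder:
  fixes x h s :: real
  assumes "0 \<le> s" "\<bar>h\<bar> \<le> x / 2"
  shows "\<bar>exp (- (x + h) * s) - exp (- x * s) + h * s * exp (- x * s)\<bar>
      \<le> h\<^sup>2 * (s\<^sup>2 * exp (- (x / 2) * s))"
proof -
  obtain t where t: "\<bar>t\<bar> \<le> \<bar>- h * s\<bar>"
    and e: "exp (- h * s) = (\<Sum>m<2. (- h * s) ^ m / fact m) + exp t / fact 2 * (- h * s) ^ 2"
    using Maclaurin_exp_le by blast
  have "exp (- (x + h) * s) = exp (- x * s) * exp (- h * s)"
    by (simp add: exp_add [symmetric] algebra_simps)
  also have "\<dots> = exp (- x * s) * (1 - h * s + exp t / 2 * (h * s)\<^sup>2)"
    unfolding e by (simp add: numeral_2_eq_2)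
  finally have "exp (- (x + h) * s) - exp (- x * s) + h * s * exp (- x * s)
      = h\<^sup>2 * (s\<^sup>2 * (exp (t - x * s) / 2))"
    by (simp add: algebra_simps exp_diff exp_minus power_mult_distrib divide_simps)
  moreover have "exp (t - x * s) \<le> exp (- (x / 2) * s)"
  proof -
    have "t \<le> \<bar>h\<bar> * s" using t \<open>0 \<le> s\<close> by (simp add: abs_mult)
    also have "\<dots> \<le> x / 2 * s" using assms by (intro mult_right_mono)
    finally show ?thesis by (simp add: algebra_simps)
  qed
  then have bound: "exp (t - x * s) / 2 \<le> exp (- (x / 2) * s)"
    using exp_ge_zero[of "t - x * s"] by linarith
  then have "h\<^sup>2 * (s\<^sup>2 * (exp (t - x * s) / 2)) \<le> h\<^sup>2 * (s\<^sup>2 * exp (- (x / 2) * s))"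
    by (intro mult_left_mono) auto
  moreover have "0 \<le> h\<^sup>2 * (s\<^sup>2 * (exp (t - x * s) / 2))" by simp
  ultimately show ?thesis by linarith
qed

lemma power_mult_exp_neg_le:
  fixes a s :: real
  assumes "0 < a" "0 \<le> s"
  shows "s ^ n * exp (- a * s) \<le> fact n / a ^ n"
proof -
  have "(a * s) ^ n / fact n \<le> exp (a * s)"
    using assms sum_le_suminf[OF summable_exp, of "{n}" "a * s"]
    by (simp add: exp_def field_simps) 
  then show ?thesis
    using assms by (simp add: exp_minus power_mult_distrib field_simps)
qed

section \<open>Second derivative of the Laplace exponent\<close>

text \<open>
  A Levy measure of a subordinator: a Borel measure on the line that is carried by \<open>(0, \<infinity>)\<close>
  and integrates \<open>min 1 s\<close>. The integral may be taken over the whole line, since \<^const>\<open>ennreal\<close>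
  sends negative reals to \<open>0\<close>.
\<close>
locale half_line_levy_measure =
  fixes \<nu> :: "real measure"
  assumes sets_eq [measurable_cong]: "sets \<nu> = sets borel"
    and null_nonpos: "emeasure \<nu> {..0} = 0"
    and finite_min: "(\<integral>\<^sup>+s. ennreal (min 1 s) \<partial>\<nu>) < \<infinity>"
begin

lemma AE_pos: "AE s in \<nu>. 0 < s"
proof (rule AE_I[of _ _ "{..0}"])
  show "{..0} \<in> sets \<nu>" by (simp add: sets_eq)
qed (auto simp: null_nonpos)

lemma integrable_min: "integrable \<nu> (\<lambda>s. min 1 s)"
proof (rule integrableI_nonneg)
  show "(\<lambda>s. min 1 s) \<in> borel_measurable \<nu>" by measurable
  show "AE s in \<nu>. 0 \<le> min 1 s" using AE_pos by eventually_elim auto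
qed (fact finite_min)

lemma integrable_bounded_by_min:
  assumes "f \<in> borel_measurable borel"
    and "\<And>s. 0 < s \<Longrightarrow> \<bar>f s\<bar> \<le> B * min 1 s"
  shows "integrable \<nu> f"
proof (rule Bochner_Integration.integrable_bound)
  show "integrable \<nu> (\<lambda>s. B * min 1 s)" using integrable_min by simp
  show "f \<in> borel_measurable \<nu>" using assms(1) by measurable
  show "AE s in \<nu>. norm (f s) \<le> norm (B * min 1 s)"
    using AE_pos
  proof eventually_elim
    case (elim s)
    show ?case using assms(2)[OF elim] by simp
  qed
qed

lemma integrable_power_exp:
  assumes "0 < a"
  shows "integrable \<nu> (\<lambda>s. s ^ Suc k * exp (- a * s))"
proof (rule integrable_bounded_by_min)
  define B where "B = max (fact (Suc k) / a ^ Suc k) (fact k / a ^ k)"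
  fix s :: real assume s: "0 < s"
  have "s ^ Suc k * exp (- a * s) \<le> B"
    using power_mult_exp_neg_le[of a s "Suc k"] assms s unfolding B_def by linarith
  moreover have "s ^ k * exp (- a * s) \<le> B"
    using power_mult_exp_neg_le[of a s k] assms s unfolding B_def by linarith
  then have "s ^ Suc k * exp (- a * s) \<le> B * s"
    using s by (simp add: mult.assoc mult.commute[of B])
  ultimately show "\<bar>s ^ Suc k * exp (- a * s)\<bar> \<le> B * min 1 s"
    using s by (simp add: min_def)
qed measurable

lemma integrable_one_minus_exp:
  assumes "0 \<le> a"
  shows "integrable \<nu> (\<lambda>s. 1 - exp (- a * s))"
proof (rule integrable_bounded_by_min)
  fix s :: real assume s: "0 < s"
  have "1 - exp (- a * s) \<le> a * s" using exp_ge_add_one_self[of "- a * s"] by simp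
  moreover have "1 - exp (- a * s) \<le> 1" "0 \<le> 1 - exp (- a * s)" using s assms by auto
  moreover have "1 \<le> max 1 a" "a * s \<le> max 1 a * s" using s by (auto intro: mult_right_mono)
  ultimately have "\<bar>1 - exp (- a * s)\<bar> \<le> max 1 a * 1" "\<bar>1 - exp (- a * s)\<bar> \<le> max 1 a * s"
    by linarith+
  then show "\<bar>1 - exp (- a * s)\<bar> \<le> max 1 a * min 1 s"
    by (simp only: min_def split: if_split) simp
qed measurable

text \<open>
  The exponent of \<open>s\<close> is positive since \<open>exp (-y s)\<close> itself is not \<open>\<nu>\<close>-integrable when \<open>\<nu>\<close> is infinite;
  this is also why \<open>1 - exp (-y s)\<close> is treated separately.
\<close>
lemma has_derivative_power_exp:
  assumes x: "0 < x"
  shows "((\<lambda>y. LINT s|\<nu>. s ^ Suc k * exp (- y * s)) has_real_derivative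
          (LINT s|\<nu>. - (s ^ Suc (Suc k) * exp (- x * s)))) (at x)"
proof (rule has_real_derivative_integral[where d = "x / 2"
      and g = "\<lambda>s. s ^ Suc (Suc (Suc k)) * exp (- (x / 2) * s)"])
  fix h assume h: "\<bar>h\<bar> \<le> x / 2"
  show "integrable \<nu> (\<lambda>s. s ^ Suc k * exp (- (x + h) * s))"
    using h x by (intro integrable_power_exp) linarith
  show "AE s in \<nu>. \<bar>s ^ Suc k * exp (- (x + h) * s) - s ^ Suc k * exp (- x * s)
         - h * - (s ^ Suc (Suc k) * exp (- x * s))\<bar>
      \<le> h\<^sup>2 * (s ^ Suc (Suc (Suc k)) * exp (- (x / 2) * s))"
    using AE_pos
  proof eventually_elim
    case (elim s)
    have "s ^ Suc k * exp (- (x + h) * s) - s ^ Suc k * exp (- x * s)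
         - h * - (s ^ Suc (Suc k) * exp (- x * s))
       = s ^ Suc k * (exp (- (x + h) * s) - exp (- x * s) + h * s * exp (- x * s))"
      by (simp add: algebra_simps)
    also have "\<bar>\<dots>\<bar> \<le> s ^ Suc k * (h\<^sup>2 * (s\<^sup>2 * exp (- (x / 2) * s)))"
      unfolding abs_mult using exp_neg_quadratic_remainder[of s h x] elim h
      by (intro mult_mono) auto
    finally show ?case by (simp add: power2_eq_square algebra_simps)
  qed
qed (use x integrable_power_exp[of x "Suc k"] integrable_power_exp[of "x / 2" "Suc (Suc k)"] in auto)

lemma has_derivative_one_minus_exp:
  assumes x: "0 < x"
  shows "((\<lambda>y. LINT s|\<nu>. 1 - exp (- y * s)) has_real_derivative
          (LINT s|\<nu>. s ^ Suc 0 * exp (- x * s))) (at x)"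
proof (rule has_real_derivative_integral[where d = "x / 2"
      and g = "\<lambda>s. s ^ Suc (Suc 0) * exp (- (x / 2) * s)"])
  fix h assume h: "\<bar>h\<bar> \<le> x / 2"
  show "integrable \<nu> (\<lambda>s. 1 - exp (- (x + h) * s))"
    using h x by (intro integrable_one_minus_exp) linarith
  show "AE s in \<nu>. \<bar>1 - exp (- (x + h) * s) - (1 - exp (- x * s))
         - h * (s ^ Suc 0 * exp (- x * s))\<bar>
      \<le> h\<^sup>2 * (s ^ Suc (Suc 0) * exp (- (x / 2) * s))"
    using AE_pos
  proof eventually_elim
    case (elim s)
    have "1 - exp (- (x + h) * s) - (1 - exp (- x * s)) - h * (s ^ Suc 0 * exp (- x * s))
       = - (exp (- (x + h) * s) - exp (- x * s) + h * s * exp (- x * s))"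
      by (simp add: algebra_simps)
    then show ?case
      using exp_neg_quadratic_remainder[of s h x] elim h
      by (simp only: abs_minus_cancel power2_eq_square power_Suc power_0 mult_1_right)
  qed
qed (use x integrable_power_exp[of x 0] integrable_power_exp[of "x / 2" "Suc 0"] in auto)

lemma second_deriv_laplace_exponent:
  assumes \<phi>: "\<And>l. 0 \<le> l \<Longrightarrow> \<phi> l = b * l + (LINT s|\<nu>. 1 - exp (- l * s))"
    and x: "0 < x"
  shows "deriv (deriv \<phi>) x = - (LINT s|\<nu>. s\<^sup>2 * exp (- x * s))"
proof -
  have first: "deriv \<phi> y = b + (LINT s|\<nu>. s ^ Suc 0 * exp (- y * s))" if y: "0 < y" for y
  proof (rule DERIV_imp_deriv)
    have "((\<lambda>l. b * l + (LINT s|\<nu>. 1 - exp (- l * s))) has_real_derivative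
        b + (LINT s|\<nu>. s ^ Suc 0 * exp (- y * s))) (at y)"
      by (rule derivative_eq_intros has_derivative_one_minus_exp[OF y] | simp)+
    moreover have "\<forall>\<^sub>F l in nhds y. l \<in> {0<..}"
      using y by (intro eventually_nhds_in_open) auto
    then have "\<forall>\<^sub>F l in nhds y. \<phi> l = b * l + (LINT s|\<nu>. 1 - exp (- l * s))"
      by (rule eventually_mono) (rule \<phi>, simp)
    ultimately show "(\<phi> has_real_derivative b + (LINT s|\<nu>. s ^ Suc 0 * exp (- y * s))) (at y)"
      by (simp only: DERIV_cong_ev[OF refl _ refl])
  qed
  have "((\<lambda>y. b + (LINT s|\<nu>. s ^ Suc 0 * exp (- y * s))) has_real_derivative
      (LINT s|\<nu>. - (s ^ Suc (Suc 0) * exp (- x * s)))) (at x)"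
    by (rule derivative_eq_intros has_derivative_power_exp[OF x] | simp)+
  moreover have "\<forall>\<^sub>F y in nhds x. y \<in> {0<..}"
    using x by (intro eventually_nhds_in_open) auto
  then have "\<forall>\<^sub>F y in nhds x. deriv \<phi> y = b + (LINT s|\<nu>. s ^ Suc 0 * exp (- y * s))"
    by (rule eventually_mono) (rule first, simp)
  ultimately have "(deriv \<phi> has_real_derivative
      (LINT s|\<nu>. - (s ^ Suc (Suc 0) * exp (- x * s)))) (at x)"
    by (simp only: DERIV_cong_ev[OF refl _ refl])
  from DERIV_imp_deriv[OF this] show ?thesis
    by (simp add: power2_eq_square mult.assoc)
qed

section \<open>Truncated second moments and tails\<close>

lemma emeasure_tail_finite:
  assumes "0 < r"
  shows "emeasure \<nu> {r<..} < \<infinity>"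
proof -
  have "emeasure \<nu> {r<..} = (\<integral>\<^sup>+s. indicator {r<..} s \<partial>\<nu>)"
    by (simp add: sets_eq)
  also have "\<dots> \<le> (\<integral>\<^sup>+s. ennreal (1 / min 1 r) * ennreal (min 1 s) \<partial>\<nu>)"
  proof (rule nn_integral_mono)
    fix s
    have "1 \<le> 1 / min 1 r * min 1 s" if "r < s"
      using that assms by (simp add: field_simps)
    then show "indicator {r<..} s \<le> ennreal (1 / min 1 r) * ennreal (min 1 s)"
      using assms by (auto simp: indicator_def ennreal_mult' [symmetric] ennreal_ge_1)
  qed
  also have "\<dots> = ennreal (1 / min 1 r) * (\<integral>\<^sup>+s. ennreal (min 1 s) \<partial>\<nu>)"
    by (rule nn_integral_cmult) measurable
  also have "\<dots> < \<infinity>"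
    using finite_min by (simp add: ennreal_mult_less_top)
  finally show ?thesis .
qed

lemma sigma_finite: "sigma_finite_measure \<nu>"
proof
  show "\<exists>A. countable A \<and> A \<subseteq> sets \<nu> \<and> \<Union> A = space \<nu> \<and> (\<forall>a\<in>A. emeasure \<nu> a \<noteq> \<infinity>)"
  proof (intro exI[of _ "insert {..0} (range (\<lambda>n. {1 / real (Suc n)<..}))"] conjI)
    have "x \<in> (\<Union>n. {1 / real (Suc n)<..})" if "0 < x" for x
      using reals_Archimedean[OF that] by (auto simp: inverse_eq_divide)
    then have "UNIV \<subseteq> \<Union> (insert {..0} (range (\<lambda>n. {1 / real (Suc n)<..})))"
      by (metis Union_insert UnI1 UnI2 atMost_iff not_le subsetI)
    then show "\<Union> (insert {..0} (range (\<lambda>n. {1 / real (Suc n)<..}))) = space \<nu>"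
      using sets_eq_imp_space_eq[OF sets_eq] by auto
    show "\<forall>a\<in>insert {..0} (range (\<lambda>n. {1 / real (Suc n)<..})). emeasure \<nu> a \<noteq> \<infinity>"
      using emeasure_tail_finite by (auto simp: null_nonpos less_top)
  qed (auto simp: sets_eq)
qed

text \<open>
  The layer-cake formula for \<open>(min (k s) a)\<^sup>2\<close>. The factor \<open>k\<close> makes it applicable to \<open>\<nu>\<close> and to
  the image of \<open>\<nu>\<close> under dilation, so that no change of variables in \<open>u\<close> is needed later.
\<close>
lemma truncated_square_eq_tail_integral:
  assumes "0 < k" "0 \<le> a"
  shows "(\<integral>\<^sup>+s. ennreal ((min (k * s) a)\<^sup>2) \<partial>\<nu>)
      = (\<integral>\<^sup>+u. ennreal (2 * u) * indicator {0..a} u * emeasure \<nu> {u / k<..} \<partial>lborel)"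
proof -
  interpret \<nu>: sigma_finite_measure \<nu> by (rule sigma_finite)
  interpret pair_sigma_finite \<nu> lborel ..
  have sq: "ennreal ((min (k * s) a)\<^sup>2)
      = (\<integral>\<^sup>+u. ennreal (2 * u) * indicator {0..a} u * indicator {u / k<..} s \<partial>lborel)"
    if s: "0 < s" for s
  proof -
    define m where "m = min (k * s) a"
    have m: "0 \<le> m" using s assms by (simp add: m_def)
    have "ennreal (m\<^sup>2) = ennreal (m\<^sup>2 - 0\<^sup>2)" by simp
    also have "\<dots> = (\<integral>\<^sup>+u. ennreal (2 * u) * indicator {0..m} u \<partial>lborel)"
      by (rule nn_integral_FTC_Icc [symmetric]) (use m in \<open>auto intro!: derivative_eq_intros\<close>)
    also have "\<dots> = (\<integral>\<^sup>+u. ennreal (2 * u) * indicator {0..a} u * indicator {u / k<..} s \<partial>lborel)"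
    proof (rule nn_integral_cong_AE)
      \<comment> \<open>The two integrands can differ only at \<open>u = m\<close>, where \<open>u / k < s\<close> may fail.\<close>
      show "AE u in lborel. ennreal (2 * u) * indicator {0..m} u
          = ennreal (2 * u) * indicator {0..a} u * indicator {u / k<..} s"
        using AE_lborel_singleton[of m]
      proof eventually_elim
        case (elim u)
        have "u / k < s \<longleftrightarrow> u < k * s" using assms by (simp add: field_simps)
        then show ?case using elim by (auto simp: indicator_def m_def min_def split: if_splits)
      qed
    qed
    finally show ?thesis unfolding m_def .
  qed
  have "(\<integral>\<^sup>+s. ennreal ((min (k * s) a)\<^sup>2) \<partial>\<nu>)
      = (\<integral>\<^sup>+s. (\<integral>\<^sup>+u. ennreal (2 * u) * indicator {0..a} u * indicator {u / k<..} s \<partial>lborel) \<partial>\<nu>)"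
    by (rule nn_integral_cong_AE, rule AE_mp[OF AE_pos]) (simp add: sq)
  also have "\<dots> = (\<integral>\<^sup>+u. (\<integral>\<^sup>+s. ennreal (2 * u) * indicator {0..a} u * indicator {u / k<..} s \<partial>\<nu>) \<partial>lborel)"
    by (rule Fubini' [symmetric]) (simp add: indicator_def)
  also have "\<dots> = (\<integral>\<^sup>+u. ennreal (2 * u) * indicator {0..a} u * emeasure \<nu> {u / k<..} \<partial>lborel)"
    by (intro nn_integral_cong nn_integral_cmult_indicator) (simp add: sets_eq)
  finally show ?thesis .
qed

lemma truncated_square_integral_scaling:
  assumes "0 < a" "1 \<le> l" "0 \<le> D"
    and tail: "\<And>u. 0 < u \<Longrightarrow> u \<le> a \<Longrightarrow> emeasure \<nu> {u<..} \<le> ennreal D * emeasure \<nu> {u / l<..}"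
  shows "(\<integral>\<^sup>+s. ennreal ((min s a)\<^sup>2) \<partial>\<nu>)
      \<le> ennreal (D * l\<^sup>2) * (\<integral>\<^sup>+s. ennreal ((min s (a / l))\<^sup>2) \<partial>\<nu>)"
proof -
  interpret \<nu>: sigma_finite_measure \<nu> by (rule sigma_finite)
  have "emeasure \<nu> {u<..} = (\<integral>\<^sup>+s. indicator {u<..} s \<partial>\<nu>)" for u
    by (simp add: sets_eq)
  then have [measurable]: "(\<lambda>u. emeasure \<nu> {u<..}) \<in> borel_measurable borel"
    by (simp add: indicator_def)
  have "(\<integral>\<^sup>+s. ennreal ((min s a)\<^sup>2) \<partial>\<nu>)
      = (\<integral>\<^sup>+u. ennreal (2 * u) * indicator {0..a} u * emeasure \<nu> {u<..} \<partial>lborel)"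
    using truncated_square_eq_tail_integral[of 1 a] assms by simp
  also have "\<dots> \<le> (\<integral>\<^sup>+u. ennreal D * (ennreal (2 * u) * indicator {0..a} u * emeasure \<nu> {u / l<..}) \<partial>lborel)"
  proof (rule nn_integral_mono)
    fix u
    show "ennreal (2 * u) * indicator {0..a} u * emeasure \<nu> {u<..}
        \<le> ennreal D * (ennreal (2 * u) * indicator {0..a} u * emeasure \<nu> {u / l<..})"
    proof (cases "0 < u \<and> u \<le> a")
      case True
      then show ?thesis
        using mult_left_mono[OF tail[of u], of "ennreal (2 * u)"] by (simp add: mult_ac)
    next
      case False
      then consider "u \<le> 0" | "u > a" by linarith
      then show ?thesis by cases (auto simp: ennreal_neg)
    qed
  qed
  also have "\<dots> = ennreal D * (\<integral>\<^sup>+u. ennreal (2 * u) * indicator {0..a} u * emeasure \<nu> {u / l<..} \<partial>lborel)"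
    by (rule nn_integral_cmult) measurable
  also have "\<dots> = ennreal D * (\<integral>\<^sup>+s. ennreal ((min (l * s) a)\<^sup>2) \<partial>\<nu>)"
    using truncated_square_eq_tail_integral[of l a] assms by simp
  also have "\<dots> = ennreal D * (\<integral>\<^sup>+s. ennreal (l\<^sup>2) * ennreal ((min s (a / l))\<^sup>2) \<partial>\<nu>)"
  proof -
    have "min (l * s) a = l * min s (a / l)" for s
      using assms by (simp add: min_def field_simps)
    then show ?thesis by (simp add: power_mult_distrib ennreal_mult)
  qed
  also have "\<dots> = ennreal (D * l\<^sup>2) * (\<integral>\<^sup>+s. ennreal ((min s (a / l))\<^sup>2) \<partial>\<nu>)"
    using assms by (simp add: nn_integral_cmult ennreal_mult mult.assoc)
  finally show ?thesis .
qed

lemma exp_integral_le_truncated_square_integral: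
  assumes "0 < x"
  shows "(\<integral>\<^sup>+s. ennreal (s\<^sup>2 * exp (- x * s)) \<partial>\<nu>) \<le> (\<integral>\<^sup>+s. ennreal ((min s (1 / x))\<^sup>2) \<partial>\<nu>)"
proof (rule nn_integral_mono_AE)
  have *: "s\<^sup>2 * exp (- x * s) \<le> (min s (1 / x))\<^sup>2" if s: "0 < s" for s
  proof (cases "s \<le> 1 / x")
    case True
    then have "min s (1 / x) = s" by simp
    then show ?thesis using assms s by (simp add: mult_left_le)
  next
    case False
    \<comment> \<open>With \<open>t = x s / 2\<close> this is \<open>2 t \<le> exp t\<close>, which follows from \<open>2 \<le> exp 1\<close> and \<open>t \<le> exp (t - 1)\<close>.\<close>
    have "exp (x * s / 2) \<ge> x * s"
    proof -
      have "exp 1 \<ge> (2::real)" using exp_ge_add_one_self[of 1] by simp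
      moreover have "exp (x * s / 2 - 1) \<ge> x * s / 2" using exp_ge_add_one_self[of "x * s / 2 - 1"] by simp
      ultimately have "2 * (x * s / 2) \<le> exp 1 * exp (x * s / 2 - 1)"
        using assms s by (intro mult_mono) auto
      then show ?thesis by (simp add: exp_add [symmetric])
    qed
    then have "(x * s)\<^sup>2 \<le> (exp (x * s / 2))\<^sup>2"
      using assms s by (intro power_mono) auto
    also have "\<dots> = exp (x * s)" by (simp add: exp_double [symmetric])
    finally have "s\<^sup>2 * exp (- x * s) \<le> (1 / x)\<^sup>2"
      using assms by (simp add: exp_minus field_simps power_mult_distrib)
    then show ?thesis using False by simp
  qed
  show "AE s in \<nu>. ennreal (s\<^sup>2 * exp (- x * s)) \<le> ennreal ((min s (1 / x))\<^sup>2)"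
    using AE_pos by eventually_elim (intro ennreal_leI *)
qed

text \<open>
  The factor \<open>exp (-y s)\<close> damps large \<open>s\<close>, so this converse bound needs the tail assumption: it
  allows the mass beyond \<open>1/y\<close> to be absorbed by the mass of \<open>(q/y, 1/y]\<close>.
\<close>
lemma truncated_square_integral_le_exp_integral:
  assumes "0 < y" "0 < q" "q \<le> 1"
    and tail: "2 * emeasure \<nu> {1 / y<..} \<le> emeasure \<nu> {q / y<..}"
  shows "(\<integral>\<^sup>+s. ennreal ((min s (1 / y))\<^sup>2) \<partial>\<nu>)
      \<le> ennreal ((1 + 1 / q\<^sup>2) * exp 1) * (\<integral>\<^sup>+s. ennreal (s\<^sup>2 * exp (- y * s)) \<partial>\<nu>)"
proof -
  define a where "a = 1 / y"
  have a: "0 < a" "q * a = q / y" "q * a \<le> a" using assms by (auto simp: a_def field_simps)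
  define S where "S = (\<integral>\<^sup>+s. ennreal (s\<^sup>2) * indicator {..a} s \<partial>\<nu>)"
  have "emeasure \<nu> {a<..} + emeasure \<nu> {a<..} \<le> emeasure \<nu> {q * a<..}"
    using tail by (simp add: a_def mult_2)
  also have "{q * a<..} = {q * a<..a} \<union> {a<..}" using a by auto
  also have "emeasure \<nu> \<dots> = emeasure \<nu> {q * a<..a} + emeasure \<nu> {a<..}"
    by (rule plus_emeasure [symmetric]) (auto simp: sets_eq)
  finally have mass: "emeasure \<nu> {a<..} \<le> emeasure \<nu> {q * a<..a}"
    using emeasure_tail_finite[OF a(1)] by (auto simp: add.commute ennreal_add_left_cancel_le)
  have "ennreal (a\<^sup>2) * emeasure \<nu> {a<..} \<le> ennreal (a\<^sup>2) * emeasure \<nu> {q * a<..a}"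
    by (intro mult_left_mono mass) simp
  also have "\<dots> = (\<integral>\<^sup>+s. ennreal (a\<^sup>2) * indicator {q * a<..a} s \<partial>\<nu>)"
    by (rule nn_integral_cmult_indicator [symmetric]) (simp add: sets_eq)
  also have "\<dots> \<le> (\<integral>\<^sup>+s. ennreal (1 / q\<^sup>2) * (ennreal (s\<^sup>2) * indicator {..a} s) \<partial>\<nu>)"
  proof (rule nn_integral_mono)
    fix s
    have "a\<^sup>2 \<le> 1 / q\<^sup>2 * s\<^sup>2" if "q * a < s"
    proof -
      have "(q * a)\<^sup>2 \<le> s\<^sup>2" using that a assms by (intro power_mono) auto
      then show ?thesis using assms by (simp add: field_simps power_mult_distrib)
    qed
    then show "ennreal (a\<^sup>2) * indicator {q * a<..a} s
        \<le> ennreal (1 / q\<^sup>2) * (ennreal (s\<^sup>2) * indicator {..a} s)"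
      by (auto simp: indicator_def ennreal_mult' [symmetric] intro!: ennreal_leI)
  qed
  also have "\<dots> = ennreal (1 / q\<^sup>2) * S"
    unfolding S_def by (rule nn_integral_cmult) measurable
  finally have large: "ennreal (a\<^sup>2) * emeasure \<nu> {a<..} \<le> ennreal (1 / q\<^sup>2) * S" .
  have "S \<le> (\<integral>\<^sup>+s. ennreal (exp 1) * ennreal (s\<^sup>2 * exp (- y * s)) \<partial>\<nu>)"
    unfolding S_def
  proof (rule nn_integral_mono)
    fix s
    have "s\<^sup>2 * 1 \<le> s\<^sup>2 * exp (1 - y * s)" if "s \<le> a"
      using that assms by (intro mult_left_mono) (auto simp: a_def field_simps)
    then show "ennreal (s\<^sup>2) * indicator {..a} s \<le> ennreal (exp 1) * ennreal (s\<^sup>2 * exp (- y * s))"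
      by (auto simp: indicator_def ennreal_mult' [symmetric] exp_diff exp_minus field_simps
          intro!: ennreal_leI)
  qed
  also have "\<dots> = ennreal (exp 1) * (\<integral>\<^sup>+s. ennreal (s\<^sup>2 * exp (- y * s)) \<partial>\<nu>)"
    by (rule nn_integral_cmult) measurable
  finally have small: "S \<le> \<dots>" .
  have "(\<integral>\<^sup>+s. ennreal ((min s a)\<^sup>2) \<partial>\<nu>)
      = (\<integral>\<^sup>+s. ennreal (s\<^sup>2) * indicator {..a} s + ennreal (a\<^sup>2) * indicator {a<..} s \<partial>\<nu>)"
    by (intro nn_integral_cong) (auto simp: indicator_def min_def)
  also have "\<dots> = S + ennreal (a\<^sup>2) * emeasure \<nu> {a<..}"
    unfolding S_def
    by (subst nn_integral_add) (auto simp: sets_eq nn_integral_cmult_indicator)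
  also have "\<dots> \<le> S + ennreal (1 / q\<^sup>2) * S"
    by (intro add_left_mono large)
  also have "\<dots> = ennreal (1 + 1 / q\<^sup>2) * S"
    by (simp add: ennreal_plus distrib_right del: ennreal_plus[symmetric])
  also have "\<dots> \<le> ennreal (1 + 1 / q\<^sup>2) * (ennreal (exp 1) * (\<integral>\<^sup>+s. ennreal (s\<^sup>2 * exp (- y * s)) \<partial>\<nu>))"
    by (intro mult_left_mono small) simp
  finally show ?thesis
    unfolding a_def by (simp add: ennreal_mult mult.assoc)
qed

section \<open>Weak lower scaling\<close>

text \<open>
  The number \<open>q\<close> solves \<open>C * q powr \<alpha> = 1 / 2\<close>; the tail is therefore at least doubled on
  passing from \<open>r\<close> to \<open>q * r\<close>.
\<close>
lemma exp_integral_scaling: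
  assumes "0 < x" "1 \<le> l" "1 \<le> C" "0 < \<alpha>"
    and tail: "\<And>r t. 0 < r \<Longrightarrow> r \<le> 1 / x \<Longrightarrow> 0 < t \<Longrightarrow> t \<le> 1 \<Longrightarrow>
      emeasure \<nu> {r<..} \<le> ennreal (C * t powr \<alpha>) * emeasure \<nu> {t * r<..}"
  defines "q \<equiv> (2 * C) powr (- 1 / \<alpha>)"
  shows "(LINT s|\<nu>. s\<^sup>2 * exp (- x * s))
      \<le> C * l powr (2 - \<alpha>) * ((1 + 1 / q\<^sup>2) * exp 1) * (LINT s|\<nu>. s\<^sup>2 * exp (- (l * x) * s))"
proof -
  define E where "E = (1 + 1 / q\<^sup>2) * exp 1"
  define F where "F y = (LINT s|\<nu>. s\<^sup>2 * exp (- y * s))" for y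
  have F: "ennreal (F y) = (\<integral>\<^sup>+s. ennreal (s\<^sup>2 * exp (- y * s)) \<partial>\<nu>)" and F0: "0 \<le> F y"
    if "0 < y" for y
    using integrable_power_exp[OF that, of 1] unfolding F_def
    by (auto simp: nn_integral_eq_integral power2_eq_square)
  have E: "0 \<le> E" by (simp add: E_def)
  have q: "0 < q" "q \<le> 1"
    using assms powr_mono[of "- 1 / \<alpha>" 0 "2 * C"] by (auto simp: q_def)
  have half: "C * q powr \<alpha> = 1 / 2"
    unfolding q_def powr_powr using assms by (simp add: powr_minus_divide)
  have l: "0 < l" and lx: "0 < l * x" using assms by auto
  have r: "1 / (l * x) \<le> 1 / x" using assms by (simp add: field_simps)
  have "emeasure \<nu> {1 / (l * x)<..} \<le> ennreal (1 / 2) * emeasure \<nu> {q / (l * x)<..}"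
    using tail[of "1 / (l * x)" q] q lx r by (simp add: half)
  then have "2 * emeasure \<nu> {1 / (l * x)<..} \<le> 2 * (ennreal (1 / 2) * emeasure \<nu> {q / (l * x)<..})"
    by (intro mult_left_mono) auto
  also have "\<dots> = ennreal (2 * (1 / 2)) * emeasure \<nu> {q / (l * x)<..}"
    by (subst ennreal_mult) (auto simp: mult.assoc)
  finally have halving: "2 * emeasure \<nu> {1 / (l * x)<..} \<le> emeasure \<nu> {q / (l * x)<..}" by simp
  have tail': "emeasure \<nu> {u<..} \<le> ennreal (C * l powr - \<alpha>) * emeasure \<nu> {u / l<..}"
    if "0 < u" "u \<le> 1 / x" for u
    using tail[of u "1 / l"] that assms by (simp add: powr_divide powr_minus_divide)
  have "ennreal (F x) \<le> (\<integral>\<^sup>+s. ennreal ((min s (1 / x))\<^sup>2) \<partial>\<nu>)"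
    using exp_integral_le_truncated_square_integral[of x] assms by (simp add: F)
  also have "\<dots> \<le> ennreal (C * l powr - \<alpha> * l\<^sup>2) * (\<integral>\<^sup>+s. ennreal ((min s (1 / x / l))\<^sup>2) \<partial>\<nu>)"
    using assms tail' by (intro truncated_square_integral_scaling) auto
  also have "\<dots> \<le> ennreal (C * l powr - \<alpha> * l\<^sup>2) * (ennreal E * ennreal (F (l * x)))"
    using truncated_square_integral_le_exp_integral[OF lx q halving]
    by (intro mult_left_mono) (auto simp: E_def F[OF lx] mult.commute)
  also have "\<dots> = ennreal (C * l powr (2 - \<alpha>) * E * F (l * x))"
  proof -
    have "l powr - \<alpha> * l\<^sup>2 = l powr (2 - \<alpha>)"
      using l by (simp add: powr_diff powr_minus field_simps)
    then show ?thesis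
      using assms E F0[OF lx] by (simp add: ennreal_mult' [symmetric] mult.assoc)
  qed
  finally have "F x \<le> C * l powr (2 - \<alpha>) * E * F (l * x)"
    using assms E F0[OF lx] by (subst (asm) ennreal_le_iff) auto
  then show ?thesis by (simp add: F_def E_def)
qed

end

(* The division is taken in ereal, where 1 / 0 = \<infinity>; in real, 1 / 0 would be 0. *)
theorem proposition3p8:
  fixes M :: "'a measure" and T :: "real \<Rightarrow> 'a \<Rightarrow> real"
    and \<phi> :: "real \<Rightarrow> real" and \<nu> :: "real measure"
    and x\<^sub>0 C \<alpha> :: real
  assumes "subordinator M T"
    and "laplace_exponent M T \<phi>"
    and "levy_measure \<phi> \<nu>"
    and "\<exists>x>0. deriv (deriv \<phi>) x \<noteq> 0"
    and "x\<^sub>0 \<ge> 0" and "C \<ge> 1" and "\<alpha> > 0"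
    and "\<And>r l :: real. 0 < r \<Longrightarrow> ereal r < 1 / ereal x\<^sub>0 \<Longrightarrow> 0 < l \<Longrightarrow> l \<le> 1 \<Longrightarrow>
           emeasure \<nu> {r<..} \<le> ennreal (C * l powr \<alpha>) * emeasure \<nu> {l * r<..}"
  shows "\<exists>c. 0 < c \<and> c \<le> 1 \<and> (\<lambda>x. - deriv (deriv \<phi>) x) \<in> WLSC (\<alpha> - 2) c x\<^sub>0"
proof -
  note tail = assms(8)
  have sets: "sets \<nu> = sets borel" and null: "emeasure \<nu> {..0} = 0"
    and fin: "(\<integral>\<^sup>+s\<in>{0<..}. ennreal (min 1 s) \<partial>\<nu>) < \<infinity>"
    using assms(3) by (auto simp: levy_measure_def)
  obtain b where b: "\<And>l. 0 \<le> l \<Longrightarrow> \<phi> l = b * l + (LINT s:{0<..}|\<nu>. 1 - exp (- l * s))"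
    using assms(3) by (auto simp: levy_measure_def)
  have "(\<integral>\<^sup>+s\<in>{0<..}. ennreal (min 1 s) \<partial>\<nu>) = (\<integral>\<^sup>+s. ennreal (min 1 s) \<partial>\<nu>)"
    by (intro nn_integral_cong) (auto simp: indicator_def ennreal_neg)
  with fin interpret half_line_levy_measure \<nu>
    by unfold_locales (simp_all add: sets null)
  define F where "F y = (LINT s|\<nu>. s\<^sup>2 * exp (- y * s))" for y
  have "(LINT s:{0<..}|\<nu>. 1 - exp (- l * s)) = (LINT s|\<nu>. 1 - exp (- l * s))" for l
    unfolding set_lebesgue_integral_def
    by (rule integral_cong_AE, measurable, rule AE_mp[OF AE_pos]) auto
  then have deriv2: "- deriv (deriv \<phi>) x = F x" if "0 < x" for x
    using second_deriv_laplace_exponent[of \<phi> b x] b that by (simp add: F_def)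
  define E where "E = (1 + 1 / ((2 * C) powr (- 1 / \<alpha>))\<^sup>2) * exp 1"
  have "1 * 1 \<le> E" unfolding E_def by (intro mult_mono) auto
  then have E: "1 \<le> E" by simp
  show ?thesis
  proof (intro exI[of _ "1 / (C * E)"] conjI)
    have CE: "1 * 1 \<le> C * E" using \<open>C \<ge> 1\<close> E by (intro mult_mono) auto
    then show "0 < 1 / (C * E)" "1 / (C * E) \<le> 1" by auto
    show "(\<lambda>x. - deriv (deriv \<phi>) x) \<in> WLSC (\<alpha> - 2) (1 / (C * E)) x\<^sub>0"
      unfolding WLSC_def
    proof (safe)
      fix x :: real assume "0 < x"
      then show "0 \<le> - deriv (deriv \<phi>) x"
        unfolding deriv2[OF \<open>0 < x\<close>] F_def by (intro Bochner_Integration.integral_nonneg) simp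
    next
      fix l x :: real assume l: "1 \<le> l" and x: "x\<^sub>0 < x"
      then have x_pos: "0 < x" and lx_pos: "0 < l * x" using \<open>x\<^sub>0 \<ge> 0\<close> by auto
      have range: "ereal r < 1 / ereal x\<^sub>0" if "0 < r" "r \<le> 1 / x" for r
      proof (cases "x\<^sub>0 = 0")
        case False
        then have "1 / x < 1 / x\<^sub>0" using x \<open>x\<^sub>0 \<ge> 0\<close> by (simp add: field_simps)
        then show ?thesis using that False by (simp add: one_ereal_def)
      qed (simp add: divide_ereal_def)
      have "F x \<le> C * l powr (2 - \<alpha>) * E * F (l * x)"
        unfolding F_def E_def
        using x_pos l \<open>C \<ge> 1\<close> \<open>\<alpha> > 0\<close> tail range by (intro exp_integral_scaling) auto
      then have "1 / (C * E) * l powr (\<alpha> - 2) * F x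
          \<le> 1 / (C * E) * l powr (\<alpha> - 2) * (C * l powr (2 - \<alpha>) * E * F (l * x))"
        using CE by (intro mult_left_mono) auto
      also have "\<dots> = (C * E / (C * E)) * (l powr (\<alpha> - 2) * l powr (2 - \<alpha>)) * F (l * x)"
        by (simp add: mult_ac)
      also have "\<dots> = F (l * x)"
        using l CE \<open>C \<ge> 1\<close> E by (simp add: powr_add [symmetric])
      finally show "- deriv (deriv \<phi>) (l * x) \<ge> 1 / (C * E) * l powr (\<alpha> - 2) * - deriv (deriv \<phi>) x"
        using deriv2[OF x_pos] deriv2[OF lx_pos] by simp
    qed
  qed
qed

end
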